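(* Let $p\in\mathcal P^{\log}$ and $\omega\in A_{p(\cdot)}$. Then there is a positive constant $c$ depending only on $p$ and $\omega$ such that for every $1$-finite family $Q$ of open bounded subsets of $\mathbb R$ each having Lebesgue measure $1$, and every $f\in L^{p(\cdot)}_{2\pi,\omega}$, $$\|T_Qf\|_{p(\cdot),\omega}\le c\,\|f\|_{p(\cdot),\omega}.$$
   Context: Let $\mathsf T=[-\pi,\pi]$; $|B|$ denotes the Lebesgue measure of $B$. $\mathcal P$ is the set of measurable $p:\mathsf T\to[1,\infty)$ with $\operatorname{ess\,sup}_{\mathsf T}p<\infty$. $\mathcal P^{\log}$ is the set of $p\in\mathcal P$ such that $q=1/p$ satisfies, for some constant $c>0$, $|q(x)-q(y)|\le c/\ln(e+1/|x-y|)$ for all $x\ne y$ in $\mathsf T$. A weight $\omega$ is a $2\pi$-periodic Lebesgue measurable function with values in $[0,\infty]$ that is positive a.e. $L^{p(\cdot)}_{2\pi,\omega}$ is the space of $2\pi$-periodic measurable real functions $f$ with $\|f\|_{p(\cdot),\omega}=\inf\{\alpha>0:\int_{\mathsf T}|f(x)/\alpha|^{p(x)}\omega(x)\,dx\le1\}<\infty$. $p'(x)=p(x)/(p(x)-1)$ if $p(x)>1$ and $p'(x)=\infty$ if $p(x)=1$. $A_{p(\cdot)}$ is the class of weights $\omega$ with $$\sup_{B}\frac{\|\omega\|_{L^1(B)}}{|B|^{p_B}}\left\|\frac1\omega\right\|_{B,p'(\cdot)/p(\cdot)}<\infty,\qquad \frac1{p_B}=\frac1{|B|}\int_B\frac{dx}{p(x)},$$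 the supremum being over intervals $B\subseteq\mathsf T$ of positive length. Here $\|g\|_{B,q(\cdot)}=\inf\{\alpha>0:\int_B\varphi_{q(x)}(|g(x)|/\alpha)\,dx\le1\}$ with $\varphi_q(t)=t^q$ for $0<q<\infty$, and $\varphi_\infty(t)=0$ for $t\le1$, $\varphi_\infty(t)=\infty$ for $t>1$; $p'(x)/p(x)=1/(p(x)-1)$, equal to $\infty$ where $p(x)=1$. A family $Q$ of measurable subsets of $\mathbb R$ is (locally) $1$-finite if $\sum_{U\in Q}\chi_U(x)\le1$ for a.e. $x\in\mathbb R$ (for open sets: the sets are pairwise disjoint). For an open set $U$ of finite positive measure, $A_Uf=\frac1{|U|}\int_{U\cap\mathsf T}|f(t)|\,dt$, and the averaging operator is $T_Qf(x)=\sum_{U\in Q}\chi_{U\cap\mathsf T}(x)A_Uf$, $x\in\mathsf T$. *)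

theory Defs
  imports "HOL-Analysis.Analysis" "HOL-Probability.Essential_Supremum"
begin

definition torus :: "real set"
  where "torus = {-pi..pi}"

text \<open>Exponents and weights are total functions on the reals; only the values of an exponent
  on \<^const>\<open>torus\<close> matter.\<close>

definition exponents :: "(real \<Rightarrow> real) set"
  where "exponents = {p. p \<in> borel_measurable (lebesgue_on torus) \<and> (\<forall>x\<in>torus. 1 \<le> p x) \<and>
           esssup (lebesgue_on torus) (\<lambda>x. ereal (p x)) < \<infinity>}"

definition log_exponents :: "(real \<Rightarrow> real) set"
  where "log_exponents = {p \<in> exponents. \<exists>c>0. \<forall>x\<in>torus. \<forall>y\<in>torus. x \<noteq> y \<longrightarrow>
           \<bar>1 / p x - 1 / p y\<bar> \<le> c / ln (exp 1 + 1 / \<bar>x - y\<bar>)}"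

definition periodic_2pi :: "(real \<Rightarrow> 'a) \<Rightarrow> bool"
  where "periodic_2pi f \<longleftrightarrow> (\<forall>x. f (x + 2 * pi) = f x)"

definition weight :: "(real \<Rightarrow> ennreal) \<Rightarrow> bool"
  where "weight \<omega> \<longleftrightarrow> \<omega> \<in> borel_measurable lebesgue \<and> periodic_2pi \<omega> \<and> (AE x in lebesgue. 0 < \<omega> x)"

text \<open>The power \<open>t\<^sup>q\<close> for \<open>0 < q < \<infinity>\<close> and \<open>0 \<le> t \<le> \<infinity>\<close>, extended to the exponent \<open>q = \<infinity>\<close>.
  The value at \<open>q = 0\<close> is irrelevant: no exponent used below takes it on the torus.\<close>

definition phi :: "ennreal \<Rightarrow> ennreal \<Rightarrow> ennreal"
  where "phi q t =
    (if q = \<infinity> then (if t \<le> 1 then 0 else \<infinity>)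
     else if t = \<infinity> then \<infinity>
     else ennreal (enn2real t powr enn2real q))"

text \<open>Norms take the modulus of a function as an \<^typ>\<open>ennreal\<close>-valued argument, so that they apply
  to functions which may be infinite; the infimum of the empty set is \<open>\<infinity>\<close>.\<close>

definition wnorm :: "(real \<Rightarrow> real) \<Rightarrow> (real \<Rightarrow> ennreal) \<Rightarrow> (real \<Rightarrow> ennreal) \<Rightarrow> ennreal"
  where "wnorm p \<omega> g = Inf {ennreal \<alpha> | \<alpha>. 0 < \<alpha> \<and>
           (\<integral>\<^sup>+x\<in>torus. (phi (ennreal (p x)) (g x / ennreal \<alpha>) * \<omega> x) \<partial>lebesgue) \<le> 1}"

definition Lp_2pi :: "(real \<Rightarrow> real) \<Rightarrow> (real \<Rightarrow> ennreal) \<Rightarrow> (real \<Rightarrow> real) set"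
  where "Lp_2pi p \<omega> = {f. f \<in> borel_measurable lebesgue \<and> periodic_2pi f \<and>
           wnorm p \<omega> (\<lambda>x. ennreal \<bar>f x\<bar>) < \<infinity>}"

definition local_norm :: "real set \<Rightarrow> (real \<Rightarrow> ennreal) \<Rightarrow> (real \<Rightarrow> ennreal) \<Rightarrow> ennreal"
  where "local_norm B q g = Inf {ennreal \<alpha> | \<alpha>. 0 < \<alpha> \<and>
           (\<integral>\<^sup>+x\<in>B. phi (q x) (g x / ennreal \<alpha>) \<partial>lebesgue) \<le> 1}"

definition conj_exponent :: "(real \<Rightarrow> real) \<Rightarrow> real \<Rightarrow> ennreal"
  where "conj_exponent p x = (if 1 < p x then ennreal (p x / (p x - 1)) else \<infinity>)"

definition avg_exponent :: "(real \<Rightarrow> real) \<Rightarrow> real set \<Rightarrow> real"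
  where "avg_exponent p B =
    1 / ((1 / measure lebesgue B) * (LINT x|lebesgue_on B. 1 / p x))"

text \<open>\<open>1 / \<omega>\<close> is \<open>\<infinity>\<close> where \<open>\<omega>\<close> vanishes. The convention \<open>0 \<cdot> \<infinity> = 0\<close> in the product affects
  only weights which are \<open>\<infinity>\<close> almost everywhere.\<close>

definition muckenhoupt :: "(real \<Rightarrow> real) \<Rightarrow> (real \<Rightarrow> ennreal) set"
  where "muckenhoupt p = {\<omega>. weight \<omega> \<and>
    (SUP B \<in> {B. is_interval B \<and> B \<subseteq> torus \<and> 0 < measure lebesgue B}.
       (\<integral>\<^sup>+x\<in>B. \<omega> x \<partial>lebesgue) / ennreal (measure lebesgue B powr avg_exponent p B) *
       local_norm B (\<lambda>x. conj_exponent p x / ennreal (p x)) (\<lambda>x. 1 / \<omega> x)) < \<infinity>}"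

definition one_finite :: "real set set \<Rightarrow> bool"
  where "one_finite Q \<longleftrightarrow> Q \<subseteq> sets lebesgue \<and>
    (AE x in lebesgue. (\<Sum>\<^sub>\<infinity>U\<in>Q. indicator U x :: ennreal) \<le> 1)"

definition average :: "real set \<Rightarrow> (real \<Rightarrow> real) \<Rightarrow> ennreal"
  where "average U f = (1 / emeasure lebesgue U) * (\<integral>\<^sup>+t\<in>U \<inter> torus. ennreal \<bar>f t\<bar> \<partial>lebesgue)"

definition averaging_operator :: "real set set \<Rightarrow> (real \<Rightarrow> real) \<Rightarrow> real \<Rightarrow> ennreal"
  where "averaging_operator Q f x = (\<Sum>\<^sub>\<infinity>U\<in>Q. indicator (U \<inter> torus) x * average U f)"

end

theory Submission
  imports Defs
begin

text \<open>
  The sets of \<open>Q\<close> are disjoint up to a null set and each has measure one, so at almost every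
  point the averaging operator is zero or a single average \<open>\<integral>\<^bsub>U \<inter> torus\<^esub> \<bar>f\<bar>\<close>. Hence
  \<open>T\<^sub>Q f \<le> \<parallel>f\<parallel>\<^sub>1\<close> almost everywhere, where \<open>\<parallel>f\<parallel>\<^sub>1\<close> is the \<open>L\<^sup>1\<close> norm on the torus
  (\<open>averaging_le_L1\<close>). The theorem therefore follows from two facts that do not involve \<open>Q\<close>:
  constants lie in the weighted space (\<open>wnorm_le_of_bound\<close>, which uses that \<open>\<omega>\<close> is
  integrable), and \<open>\<parallel>f\<parallel>\<^sub>1\<close> is dominated by the weighted norm of \<open>f\<close> (\<open>L1_le_of_modular\<close>, a
  form of Hoelder's inequality, which uses that \<open>1 / \<omega>\<close> has finite \<open>p' / p\<close> norm).

  Both integrability conditions come from the Muckenhoupt condition on the largest interval,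
  the torus itself. That condition bounds the product of the two quantities, so each is finite
  unless the other one is zero. Positivity of \<open>\<omega>\<close> prevents its integral from vanishing. If the
  norm of \<open>1 / \<omega>\<close> vanishes, then \<open>\<omega> = \<infinity>\<close> almost everywhere on the torus; a function of finite
  norm is then zero almost everywhere, and so is \<open>T\<^sub>Q f\<close>
  (\<open>muckenhoupt_torus_cases\<close>, \<open>modular_finite_imp_zero\<close>).
\<close>

section \<open>The integrands of the two modulars\<close>

lemma phi_mono:
  assumes "s \<le> t"
  shows "phi q s \<le> phi q t"
proof (cases "q = \<infinity> \<or> t = \<infinity>")
  case True
  then show ?thesis using assms by (auto simp: phi_def top_unique)
next
  case False
  then have "s < top" "t < top"
    using assms by (auto simp: less_top[symmetric] top_unique)
  then show ?thesis using False assms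
    by (auto simp: phi_def intro!: ennreal_leI powr_mono2 enn2real_mono)
qed

lemma dual_exponent_div:
  "conj_exponent p x / ennreal (p x) = (if 1 < p x then ennreal (1 / (p x - 1)) else \<infinity>)"
proof (cases "1 < p x")
  case True
  then show ?thesis by (simp add: conj_exponent_def divide_ennreal)
next
  case False
  then show ?thesis by (simp add: conj_exponent_def ennreal_top_divide)
qed

text \<open>
  A Young inequality for the modulars of \<open>f\<close> and \<open>1 / \<omega>\<close>. For \<open>p > 1\<close> the second summand is
  the number \<open>h\<close> with \<open>h\<^bsup>p - 1\<^esup> = 1 / (a w)\<close>: below \<open>h\<close> the value \<open>t\<close> is dominated by \<open>h\<close> itself,
  and above it \<open>t\<^bsup>p - 1\<^esup> \<ge> 1 / (a w)\<close>, that is, \<open>t \<le> a t\<^sup>p w\<close>. For \<open>p = 1\<close> the second summand is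
  \<open>0\<close> or \<open>\<infinity>\<close>, and it is \<open>0\<close> only if \<open>1 \<le> a w\<close>. The constant \<open>a\<close> is the
  same for all values of \<open>p\<close>, so the inequality can be integrated with a variable exponent.
\<close>

lemma young_phi:
  fixes t a :: real and w :: ennreal
  assumes p: "1 \<le> p x" and t: "0 \<le> t" and a: "0 < a"
  shows "ennreal t \<le> ennreal a * (phi (ennreal (p x)) (ennreal t) * w)
           + phi (conj_exponent p x / ennreal (p x)) (1 / w / ennreal a)"
proof -
  consider "w = 0" | "w = top" | "t = 0" | v where "w = ennreal v" "0 < v" "0 < t"
    by (metis ennreal_cases ennreal_0 less_eq_real_def t)
  then show ?thesis
  proof cases
    case 1
    (* The second summand is infinite, for p = 1 as well as for p > 1. *)
    have "1 / w / ennreal a = top"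
      using 1 a by (simp add: ennreal_top_divide)
    then show ?thesis by (simp add: phi_def dual_exponent_div top_unique)
  next
    case 2
    show ?thesis
    proof (cases "t = 0")
      case False
      then have "phi (ennreal (p x)) (ennreal t) \<noteq> 0" using t by (simp add: phi_def)
      then show ?thesis using 2 a by (simp add: ennreal_mult_top)
    qed simp
  next
    case 3 then show ?thesis by simp
  next
    case (4 v)
    have ph: "phi (ennreal (p x)) (ennreal t) = ennreal (t powr p x)"
      using 4 p by (simp add: phi_def)
    have dv: "1 / w / ennreal a = ennreal (1 / (v * a))"
      using 4 a by (simp add: divide_ennreal flip: ennreal_1)
    have main: "ennreal t \<le> ennreal a * (ennreal (t powr p x) * w)"
      if "1 / (v * a) \<le> t powr (p x - 1)"
    proof -
      have "1 \<le> a * v * t powr (p x - 1)"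
        using that a \<open>0 < v\<close> by (simp add: field_simps)
      then have "t * 1 \<le> t * (a * v * t powr (p x - 1))"
        using t by (intro mult_left_mono)
      also have "\<dots> = a * (t powr p x * v)"
        using \<open>0 < t\<close> by (simp add: powr_diff)
      finally show ?thesis
        using 4 a by (simp add: ennreal_mult[symmetric])
    qed
    show ?thesis
    proof (cases "1 < p x")
      case False
      with p have p1: "p x = 1" by simp
      show ?thesis
      proof (cases "1 / (v * a) \<le> 1")
        case True
        then show ?thesis using main 4 p1 unfolding ph by (simp add: add_increasing2)
      next
        case False
        then have "phi \<infinity> (ennreal (1 / (v * a))) = \<infinity>"
          by (simp add: phi_def)
        moreover have "conj_exponent p x / ennreal (p x) = \<infinity>"
          using dual_exponent_div[of p x] p1 by simp
        ultimately show ?thesis unfolding dv by simp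
      qed
    next
      case True
      let ?h = "(1 / (v * a)) powr (1 / (p x - 1))"
      have h: "phi (conj_exponent p x / ennreal (p x)) (1 / w / ennreal a) = ennreal ?h"
        unfolding dv using True 4 a by (simp add: phi_def dual_exponent_div)
      show ?thesis
      proof (cases "t \<le> ?h")
        case True
        then show ?thesis unfolding h by (simp add: add_increasing)
      next
        case False
        then have "?h powr (p x - 1) \<le> t powr (p x - 1)"
          using True by (intro powr_mono2) auto
        then have "1 / (v * a) \<le> t powr (p x - 1)"
          using True 4 a by (simp add: powr_powr)
        then show ?thesis using main unfolding ph by (simp add: add_increasing2)
      qed
    qed
  qed
qed

text \<open>
  An exponent is only assumed to be measurable on the torus. Multiplying it by the indicator of
  the torus makes it measurable on the line and does not change modulars, which integrate over
  the torus.
\<close>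

lemma exponents_measurable:
  assumes "p \<in> exponents"
  shows "(\<lambda>x. p x * indicator torus x) \<in> borel_measurable lebesgue"
proof -
  have "p \<in> borel_measurable (lebesgue_on torus)" using assms by (simp add: exponents_def)
  then show ?thesis
    by (subst (asm) borel_measurable_restrict_space_iff) (auto simp: torus_def mult.commute)
qed

lemma phi_measurable:
  assumes [measurable]: "q \<in> borel_measurable M" "g \<in> borel_measurable M"
  shows "(\<lambda>x. phi (q x) (g x)) \<in> borel_measurable M"
  unfolding phi_def by measurable

lemma torus_sets [measurable]: "torus \<in> sets lebesgue"
  by (simp add: torus_def)

lemma modular_measurable:
  assumes p: "p \<in> exponents" and [measurable]: "g \<in> borel_measurable lebesgue" "w \<in> borel_measurable lebesgue"
  shows "(\<lambda>x. phi (ennreal (p x)) (g x) * w x * indicator torus x) \<in> borel_measurable lebesgue"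
proof -
  have [measurable]: "(\<lambda>x. phi (ennreal (p x * indicator torus x)) (g x)) \<in> borel_measurable lebesgue"
    using exponents_measurable[OF p] by (intro phi_measurable) auto
  have "(\<lambda>x. phi (ennreal (p x * indicator torus x)) (g x) * w x * indicator torus x) \<in> borel_measurable lebesgue"
    by measurable
  moreover have "(\<lambda>x. phi (ennreal (p x * indicator torus x)) (g x) * w x * indicator torus x)
     = (\<lambda>x. phi (ennreal (p x)) (g x) * w x * indicator torus x)"
    by (auto simp: fun_eq_iff split: split_indicator)
  ultimately show ?thesis by simp
qed

lemma dual_modular_measurable:
  assumes p: "p \<in> exponents" and [measurable]: "g \<in> borel_measurable lebesgue"
  shows "(\<lambda>x. phi (conj_exponent p x / ennreal (p x)) (g x) * indicator torus x) \<in> borel_measurable lebesgue"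
proof -
  let ?p = "\<lambda>x. p x * indicator torus x"
  have [measurable]: "?p \<in> borel_measurable lebesgue" by (rule exponents_measurable[OF p])
  have [measurable]: "(\<lambda>x. phi (if 1 < ?p x then ennreal (1 / (?p x - 1)) else \<infinity>) (g x)) \<in> borel_measurable lebesgue"
    by (intro phi_measurable) measurable
  have "(\<lambda>x. phi (if 1 < ?p x then ennreal (1 / (?p x - 1)) else \<infinity>) (g x) * indicator torus x) \<in> borel_measurable lebesgue"
    by measurable
  moreover have "(\<lambda>x. phi (if 1 < ?p x then ennreal (1 / (?p x - 1)) else \<infinity>) (g x) * indicator torus x)
     = (\<lambda>x. phi (conj_exponent p x / ennreal (p x)) (g x) * indicator torus x)"
    by (auto simp: fun_eq_iff dual_exponent_div split: split_indicator)
  ultimately show ?thesis by simp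
qed

section \<open>Embeddings between weighted spaces, constants and integrable functions\<close>

text \<open>
  Hoelder's inequality: integrate the pointwise Young inequality at \<open>t = \<bar>f\<bar> / b\<close>. The constant
  \<open>a + 1\<close> depends on \<open>\<omega>\<close> and \<open>p\<close> only through the admissible level \<open>a\<close> of the norm of \<open>1 / \<omega>\<close>.
\<close>

lemma L1_le_of_modular:
  fixes f :: "real \<Rightarrow> real" and a b :: real
  assumes p: "p \<in> exponents"
    and [measurable]: "f \<in> borel_measurable lebesgue" "w \<in> borel_measurable lebesgue"
    and a: "0 < a"
    and dual: "(\<integral>\<^sup>+x\<in>torus. phi (conj_exponent p x / ennreal (p x)) (1 / w x / ennreal a) \<partial>lebesgue) \<le> 1"
    and b: "0 < b"
    and prim: "(\<integral>\<^sup>+x\<in>torus. (phi (ennreal (p x)) (ennreal \<bar>f x\<bar> / ennreal b) * w x) \<partial>lebesgue) \<le> 1"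
  shows "(\<integral>\<^sup>+x\<in>torus. ennreal \<bar>f x\<bar> \<partial>lebesgue) \<le> ennreal ((a + 1) * b)"
proof -
  let ?F = "\<lambda>x. phi (ennreal (p x)) (ennreal \<bar>f x\<bar> / ennreal b) * w x * indicator torus x"
  let ?G = "\<lambda>x. phi (conj_exponent p x / ennreal (p x)) (1 / w x / ennreal a) * indicator torus x"
  have [measurable]: "?F \<in> borel_measurable lebesgue" "?G \<in> borel_measurable lebesgue"
    by (auto intro!: modular_measurable[OF p] dual_modular_measurable[OF p])
  have "(\<integral>\<^sup>+x\<in>torus. ennreal \<bar>f x\<bar> \<partial>lebesgue) \<le> (\<integral>\<^sup>+x. ennreal b * (ennreal a * ?F x + ?G x) \<partial>lebesgue)"
  proof (intro nn_integral_mono)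
    fix x
    show "ennreal \<bar>f x\<bar> * indicator torus x \<le> ennreal b * (ennreal a * ?F x + ?G x)"
    proof (cases "x \<in> torus")
      case True
      then have "1 \<le> p x" using p by (simp add: exponents_def)
      from young_phi[of p x "\<bar>f x\<bar> / b" a "w x"] this a b
      have "ennreal (\<bar>f x\<bar> / b) \<le> ennreal a * ?F x + ?G x"
        using True by (simp add: divide_ennreal)
      then have "ennreal b * ennreal (\<bar>f x\<bar> / b) \<le> ennreal b * (ennreal a * ?F x + ?G x)"
        by (rule mult_left_mono) simp
      moreover have "ennreal b * ennreal (\<bar>f x\<bar> / b) = ennreal \<bar>f x\<bar>"
        using b by (simp add: ennreal_mult[symmetric])
      ultimately show ?thesis using True by simp
    qed simp
  qed
  also have "\<dots> = ennreal b * (ennreal a * integral\<^sup>N lebesgue ?F + integral\<^sup>N lebesgue ?G)"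
    by (simp add: nn_integral_cmult nn_integral_add)
  also have "\<dots> \<le> ennreal b * (ennreal a * 1 + 1)"
    using dual prim by (intro mult_left_mono add_mono) auto
  also have "\<dots> = ennreal ((a + 1) * b)"
    using a b by (simp add: ennreal_mult mult.commute)
  finally show ?thesis .
qed

text \<open>
  At the level \<open>M k\<close> a function bounded by \<open>k\<close> has quotient at most \<open>1 / M \<le> 1\<close>, and powers with
  exponent at least \<open>1\<close> decrease numbers in \<open>[0, 1]\<close>. So the modular is at most \<open>1 / M\<close> times
  the total mass of the weight, which is why \<open>M\<close> must dominate both \<open>1\<close> and that mass.
\<close>

lemma wnorm_le_of_bound:
  assumes p: "p \<in> exponents" and [measurable]: "w \<in> borel_measurable lebesgue"
    and k: "0 < k" and bound: "AE x in lebesgue. x \<in> torus \<longrightarrow> g x \<le> ennreal k"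
    and W: "(\<integral>\<^sup>+x\<in>torus. w x \<partial>lebesgue) \<le> ennreal M" and M: "1 \<le> M"
  shows "wnorm p w g \<le> ennreal (M * k)"
proof -
  have "(\<integral>\<^sup>+x\<in>torus. (phi (ennreal (p x)) (g x / ennreal (M * k)) * w x) \<partial>lebesgue)
      \<le> (\<integral>\<^sup>+x. ennreal (1 / M) * (w x * indicator torus x) \<partial>lebesgue)"
  proof (rule nn_integral_mono_AE, use bound in eventually_elim)
    fix x assume gx: "x \<in> torus \<longrightarrow> g x \<le> ennreal k"
    show "phi (ennreal (p x)) (g x / ennreal (M * k)) * w x * indicator torus x
        \<le> ennreal (1 / M) * (w x * indicator torus x)"
    proof (cases "x \<in> torus")
      case True
      then have p1: "1 \<le> p x" using p by (simp add: exponents_def)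
      have "g x / ennreal (M * k) \<le> ennreal k / ennreal (M * k)"
        using gx True by (intro divide_right_mono_ennreal) auto
      also have "\<dots> = ennreal (1 / M)" using k M by (simp add: divide_ennreal)
      finally have "phi (ennreal (p x)) (g x / ennreal (M * k)) \<le> phi (ennreal (p x)) (ennreal (1 / M))"
        by (rule phi_mono)
      also have "\<dots> = ennreal ((1 / M) powr p x)" using p1 M by (simp add: phi_def)
      also have "\<dots> \<le> ennreal (1 / M)"
        using powr_mono'[of 1 "p x" "1 / M"] p1 M by (intro ennreal_leI) auto
      finally show ?thesis using True by (simp add: mult_right_mono)
    qed simp
  qed
  also have "\<dots> = ennreal (1 / M) * (\<integral>\<^sup>+x\<in>torus. w x \<partial>lebesgue)"
    by (simp add: nn_integral_cmult)
  also have "\<dots> \<le> ennreal (1 / M) * ennreal M" by (intro mult_left_mono W) simp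
  also have "\<dots> = 1" using M by (simp add: ennreal_mult[symmetric])
  finally show ?thesis
    unfolding wnorm_def using k M by (intro Inf_lower) auto
qed

text \<open>
  It suffices to test the admissible levels \<open>b\<close> in the infimum defining the norm, so that no
  attainment of the infimum has to be discussed.
\<close>

lemma le_const_wnormI:
  assumes c: "0 < c"
    and le: "\<And>b. 0 < b \<Longrightarrow>
      (\<integral>\<^sup>+x\<in>torus. (phi (ennreal (p x)) (g x / ennreal b) * w x) \<partial>lebesgue) \<le> 1 \<Longrightarrow>
      y \<le> ennreal (c * b)"
  shows "y \<le> ennreal c * wnorm p w g"
proof -
  have "y / ennreal c \<le> wnorm p w g"
    unfolding wnorm_def
  proof (rule Inf_greatest, clarify)
    fix b :: real
    assume b: "0 < b" and "(\<integral>\<^sup>+x\<in>torus. (phi (ennreal (p x)) (g x / ennreal b) * w x) \<partial>lebesgue) \<le> 1"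
    then have "y \<le> ennreal (c * b)" by (rule le)
    then have "y / ennreal c \<le> ennreal (c * b) / ennreal c" by (rule divide_right_mono_ennreal)
    also have "\<dots> = ennreal b" using b c by (simp add: divide_ennreal)
    finally show "y / ennreal c \<le> ennreal b" .
  qed
  then have "ennreal c * (y / ennreal c) \<le> ennreal c * wnorm p w g" by (rule mult_left_mono) simp
  then show ?thesis using c by (simp add: ennreal_times_divide mult_divide_eq_ennreal mult.commute)
qed

section \<open>The pointwise bound for the averaging operator\<close>

text \<open>
  Every average is at most the integral over the whole torus, and at almost every point the
  sets of the family contribute with total multiplicity at most one.
\<close>

lemma averaging_le_L1:
  assumes Q: "one_finite Q" "\<forall>U\<in>Q. emeasure lebesgue U = 1"
  shows "AE x in lebesgue. averaging_operator Q f x \<le> (\<integral>\<^sup>+t\<in>torus. ennreal \<bar>f t\<bar> \<partial>lebesgue)"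
proof -
  let ?K = "\<integral>\<^sup>+t\<in>torus. ennreal \<bar>f t\<bar> \<partial>lebesgue"
  have avg: "average U f \<le> ?K" if "U \<in> Q" for U
    using Q(2) that unfolding average_def
    by (auto intro!: nn_integral_mono split: split_indicator)
  have "AE x in lebesgue. (\<Sum>\<^sub>\<infinity>U\<in>Q. indicator U x :: ennreal) \<le> 1"
    using Q(1) by (simp add: one_finite_def)
  then show ?thesis
  proof eventually_elim
    case (elim x)
    have "averaging_operator Q f x \<le> ?K"
      unfolding averaging_operator_def
      (* Finite sums, because multiplication by a possibly infinite constant need not be
         continuous in the extended half-line. *)
    proof (rule infsum_le_finite_sums)
      fix F assume F: "finite F" "F \<subseteq> Q"
      have "(\<Sum>U\<in>F. indicator (U \<inter> torus) x * average U f) \<le> (\<Sum>U\<in>F. ?K * indicator U x)"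
        using F by (intro sum_mono) (auto split: split_indicator intro: avg)
      also have "\<dots> = ?K * (\<Sum>U\<in>F. indicator U x)"
        by (simp add: sum_distrib_left)
      also have "\<dots> \<le> ?K * (\<Sum>\<^sub>\<infinity>U\<in>Q. indicator U x)"
      proof (rule mult_left_mono)
        have "infsum (\<lambda>U. indicator U x :: ennreal) F \<le> infsum (\<lambda>U. indicator U x) Q"
          using F by (intro infsum_mono_neutral nonneg_summable_on_complete) auto
        then show "(\<Sum>U\<in>F. indicator U x :: ennreal) \<le> (\<Sum>\<^sub>\<infinity>U\<in>Q. indicator U x)"
          using F by simp
      qed simp
      also have "\<dots> \<le> ?K * 1" by (intro mult_left_mono elim) simp
      finally show "(\<Sum>U\<in>F. indicator (U \<inter> torus) x * average U f) \<le> ?K" by simp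
    qed (simp add: nonneg_summable_on_complete)
    then show ?case .
  qed
qed

section \<open>Consequences of the Muckenhoupt condition on the torus\<close>

text \<open>
  The dual exponent is positive or infinite, so its powers are unbounded along \<open>r (n + 1)\<close>.
\<close>

lemma SUP_phi_dual_eq_top:
  assumes "0 < r"
  shows "(SUP n. phi (conj_exponent p x / ennreal (p x)) (r / ennreal (1 / Suc n))) = top"
  unfolding SUP_eq_top_iff
proof (intro allI impI)
  fix y :: ennreal assume "y < top"
  then obtain c where c: "y = ennreal c" "0 \<le> c" by (cases y) auto
  show "\<exists>n\<in>UNIV. y < phi (conj_exponent p x / ennreal (p x)) (r / ennreal (1 / Suc n))"
  proof (cases r)
    case top
    then have "phi (conj_exponent p x / ennreal (p x)) (r / ennreal (1 / Suc 0)) = top"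
      by (simp add: phi_def top_unique ennreal_top_divide)
    then show ?thesis using \<open>y < top\<close> by (metis UNIV_I)
  next
    case (real v)
    then have v: "0 < v" using assms by auto
    have rn: "r / ennreal (1 / Suc n) = ennreal (v * Suc n)" for n
      using real v by (simp add: divide_ennreal)
    show ?thesis
    proof (cases "1 < p x")
      case True
      obtain n where "(c + 1) powr (p x - 1) < real n * v"
        using v reals_Archimedean3 by blast
      also have "real n * v \<le> v * Suc n" using v by (simp add: mult.commute)
      finally have "((c + 1) powr (p x - 1)) powr (1 / (p x - 1)) \<le> (v * Suc n) powr (1 / (p x - 1))"
        using True by (intro powr_mono2) auto
      then have "c < (v * Suc n) powr (1 / (p x - 1))"
        using True c by (simp add: powr_powr)
      then have "y < phi (conj_exponent p x / ennreal (p x)) (r / ennreal (1 / Suc n))"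
        using True c v unfolding rn dual_exponent_div by (simp add: phi_def ennreal_lessI)
      then show ?thesis by blast
    next
      case False
      obtain n where "1 < real n * v" using v reals_Archimedean3 by blast
      also have "real n * v \<le> v * Suc n" using v by (simp add: mult.commute)
      finally have "phi \<infinity> (ennreal (v * Suc n)) = top" by (simp add: phi_def)
      then show ?thesis
        using \<open>y < top\<close> False unfolding rn dual_exponent_div
        by (intro bexI[of _ n]) (simp_all del: of_nat_Suc)
    qed
  qed
qed

text \<open>
  If the norm vanishes, every level \<open>1 / (n + 1)\<close> is admissible. The modulars increase with \<open>n\<close>
  and stay below \<open>1\<close>, so by monotone convergence their pointwise supremum is finite almost
  everywhere, whereas it is infinite wherever \<open>g\<close> is positive.
\<close>

lemma local_norm_dual_zero_imp:
  assumes p: "p \<in> exponents" and [measurable]: "g \<in> borel_measurable lebesgue"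
    and zero: "local_norm torus (\<lambda>x. conj_exponent p x / ennreal (p x)) g = 0"
  shows "AE x in lebesgue. x \<in> torus \<longrightarrow> g x = 0"
proof -
  define G where "G n x = phi (conj_exponent p x / ennreal (p x)) (g x / ennreal (1 / Suc n))
    * indicator torus x" for n :: nat and x
  have [measurable]: "G n \<in> borel_measurable lebesgue" for n
    unfolding G_def by (rule dual_modular_measurable[OF p]) measurable
  have anti: "phi q (t / ennreal b) \<le> phi q (t / ennreal a)" if "0 < a" "a \<le> b" for q t a b
  proof -
    have "t * ennreal (1 / b) \<le> t * ennreal (1 / a)"
      using that by (intro mult_left_mono ennreal_leI divide_left_mono) auto
    then show ?thesis
      using that by (intro phi_mono) (simp add: divide_ennreal_def inverse_ennreal inverse_eq_divide)
  qed
  have "incseq G"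
    unfolding G_def incseq_def le_fun_def
    by (auto intro!: mult_right_mono anti divide_left_mono)
  have le1: "integral\<^sup>N lebesgue (G n) \<le> 1" for n
  proof -
    have "local_norm torus (\<lambda>x. conj_exponent p x / ennreal (p x)) g < ennreal (1 / Suc n)"
      using zero by simp
    then obtain a where a: "0 < a" "ennreal a < ennreal (1 / Suc n)"
      "(\<integral>\<^sup>+x\<in>torus. phi (conj_exponent p x / ennreal (p x)) (g x / ennreal a) \<partial>lebesgue) \<le> 1"
      unfolding local_norm_def Inf_less_iff by auto
    then have "a \<le> 1 / Suc n" by (simp add: ennreal_less_iff)
    then have "integral\<^sup>N lebesgue (G n)
        \<le> (\<integral>\<^sup>+x\<in>torus. phi (conj_exponent p x / ennreal (p x)) (g x / ennreal a) \<partial>lebesgue)"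
      unfolding G_def using a(1) by (intro nn_integral_mono mult_right_mono anti) auto
    with a show ?thesis by simp
  qed
  have "(\<integral>\<^sup>+x. (SUP n. G n x) \<partial>lebesgue) = (SUP n. integral\<^sup>N lebesgue (G n))"
    using \<open>incseq G\<close> by (intro nn_integral_monotone_convergence_SUP) auto
  also have "\<dots> \<le> 1" by (intro SUP_least le1)
  finally have "AE x in lebesgue. (SUP n. G n x) \<noteq> \<infinity>"
    by (intro nn_integral_PInf_AE) (auto simp: top_unique)
  then show ?thesis
  proof eventually_elim
    case (elim x)
    show ?case
    proof (intro impI, rule ccontr)
      assume x: "x \<in> torus" "g x \<noteq> 0"
      then have "(SUP n. G n x) = top"
        using SUP_phi_dual_eq_top[of "g x" p x] unfolding G_def
        by (simp add: zero_less_iff_neq_zero del: SUP_eq_top_iff)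
      then show False using elim by simp
    qed
  qed
qed

text \<open>
  In the product bounded by the Muckenhoupt condition, \<open>0 \<cdot> \<infinity> = 0\<close>; hence the second case, in
  which the integral of \<open>\<omega>\<close> is infinite and the norm of \<open>1 / \<omega>\<close> is zero.
\<close>

lemma muckenhoupt_torus_cases:
  assumes p: "p \<in> exponents" and \<omega>: "\<omega> \<in> muckenhoupt p"
  obtains (finite) a where "0 < a" "(\<integral>\<^sup>+x\<in>torus. \<omega> x \<partial>lebesgue) < \<infinity>"
      "(\<integral>\<^sup>+x\<in>torus. phi (conj_exponent p x / ennreal (p x)) (1 / \<omega> x / ennreal a) \<partial>lebesgue) \<le> 1"
    | (infinite) "AE x in lebesgue. x \<in> torus \<longrightarrow> \<omega> x = \<infinity>"
proof -
  let ?W = "\<integral>\<^sup>+x\<in>torus. \<omega> x \<partial>lebesgue"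
  let ?N = "local_norm torus (\<lambda>x. conj_exponent p x / ennreal (p x)) (\<lambda>x. 1 / \<omega> x)"
  let ?m = "ennreal (measure lebesgue torus powr avg_exponent p torus)"
  have w: "weight \<omega>" and m[measurable]: "\<omega> \<in> borel_measurable lebesgue"
    using \<omega> by (auto simp: muckenhoupt_def weight_def)
  have "measure lebesgue torus = 2 * pi" by (simp add: torus_def)
  then have vol: "0 < measure lebesgue torus" by simp
  then have mpos: "?m \<noteq> 0" "?m \<noteq> top" by simp_all
  have "?W / ?m * ?N \<le> (SUP B \<in> {B. is_interval B \<and> B \<subseteq> torus \<and> 0 < measure lebesgue B}.
       (\<integral>\<^sup>+x\<in>B. \<omega> x \<partial>lebesgue) / ennreal (measure lebesgue B powr avg_exponent p B) *
       local_norm B (\<lambda>x. conj_exponent p x / ennreal (p x)) (\<lambda>x. 1 / \<omega> x))"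
    using vol by (intro SUP_upper) (auto simp: torus_def is_interval_cc)
  also have "\<dots> < \<infinity>" using \<omega> by (simp add: muckenhoupt_def)
  finally have fin: "?W / ?m * ?N < top" by simp
  have "?W \<noteq> 0"
  proof
    assume "?W = 0"
    then have "AE x in lebesgue. \<omega> x * indicator torus x = 0"
      by (subst (asm) nn_integral_0_iff_AE) auto
    moreover have "AE x in lebesgue. 0 < \<omega> x" using w by (simp add: weight_def)
    ultimately have "AE x in lebesgue. x \<notin> torus"
      by eventually_elim (auto split: split_indicator_asm)
    then have "emeasure lebesgue torus = 0"
      by (subst (asm) AE_iff_measurable[OF torus_sets]) auto
    then show False using vol by (simp add: measure_def)
  qed
  then have "?W / ?m \<noteq> 0" using mpos by simp
  then have N: "?N < top" using fin by (auto simp: ennreal_mult_less_top less_top)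
  show thesis
  proof (cases "?W < top")
    case True
    obtain a where "0 < a"
      "(\<integral>\<^sup>+x\<in>torus. phi (conj_exponent p x / ennreal (p x)) (1 / \<omega> x / ennreal a) \<partial>lebesgue) \<le> 1"
      using N unfolding local_norm_def Inf_less_iff by auto
    then show thesis using True finite by simp
  next
    case False
    then have "?W / ?m = top" by (simp add: less_top[symmetric] ennreal_top_divide mpos)
    then have "?N = 0" using fin by (auto simp: ennreal_mult_less_top)
    then have "AE x in lebesgue. x \<in> torus \<longrightarrow> 1 / \<omega> x = 0"
      by (intro local_norm_dual_zero_imp[OF p]) auto
    then show thesis by (intro infinite) simp
  qed
qed

lemma modular_finite_imp_zero:
  assumes p: "p \<in> exponents" and [measurable]: "f \<in> borel_measurable lebesgue" "w \<in> borel_measurable lebesgue"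
    and w: "AE x in lebesgue. x \<in> torus \<longrightarrow> w x = \<infinity>" and b: "0 < b"
    and fin: "(\<integral>\<^sup>+x\<in>torus. (phi (ennreal (p x)) (ennreal \<bar>f x\<bar> / ennreal b) * w x) \<partial>lebesgue) \<noteq> \<infinity>"
  shows "AE x in lebesgue. x \<in> torus \<longrightarrow> f x = 0"
proof -
  have "AE x in lebesgue. phi (ennreal (p x)) (ennreal \<bar>f x\<bar> / ennreal b) * w x * indicator torus x \<noteq> \<infinity>"
    using fin by (intro nn_integral_PInf_AE modular_measurable[OF p]) auto
  with w show ?thesis
  proof eventually_elim
    case (elim x)
    show ?case
    proof (intro impI, rule ccontr)
      assume x: "x \<in> torus" "f x \<noteq> 0"
      then have "phi (ennreal (p x)) (ennreal \<bar>f x\<bar> / ennreal b) \<noteq> 0"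
        using b by (simp add: phi_def divide_ennreal)
      then show False using elim x by (simp add: ennreal_mult_top)
    qed
  qed
qed

section \<open>Boundedness of the averaging operators\<close>

theorem theorem2p6:
  fixes p :: "real \<Rightarrow> real" and \<omega> :: "real \<Rightarrow> ennreal"
  assumes "p \<in> log_exponents" and "\<omega> \<in> muckenhoupt p"
  shows "\<exists>c::real. 0 < c \<and>
    (\<forall>Q. one_finite Q \<and> (\<forall>U\<in>Q. open U \<and> bounded U \<and> emeasure lebesgue U = 1) \<longrightarrow>
      (\<forall>f\<in>Lp_2pi p \<omega>.
        wnorm p \<omega> (averaging_operator Q f) \<le> ennreal c * wnorm p \<omega> (\<lambda>x. ennreal \<bar>f x\<bar>)))"
proof -
  have p: "p \<in> exponents" using assms(1) by (simp add: log_exponents_def)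
  have [measurable]: "\<omega> \<in> borel_measurable lebesgue"
    using assms(2) by (simp add: muckenhoupt_def weight_def)
  from p assms(2) show ?thesis
  proof (cases rule: muckenhoupt_torus_cases)
    case (finite a)
    define M where "M = max 1 (enn2real (\<integral>\<^sup>+x\<in>torus. \<omega> x \<partial>lebesgue))"
    have M: "1 \<le> M" "(\<integral>\<^sup>+x\<in>torus. \<omega> x \<partial>lebesgue) \<le> ennreal M"
      using finite(2) by (auto simp: M_def ennreal_enn2real_if max_def less_top[symmetric] not_le
        intro: order_trans[OF _ ennreal_leI, of _ "enn2real _"])
    have "wnorm p \<omega> (averaging_operator Q f) \<le> ennreal (M * (a + 1)) * wnorm p \<omega> (\<lambda>x. ennreal \<bar>f x\<bar>)"
      if Q: "one_finite Q" "\<forall>U\<in>Q. emeasure lebesgue U = 1" and f: "f \<in> Lp_2pi p \<omega>" for Q f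
    proof (rule le_const_wnormI)
      have [measurable]: "f \<in> borel_measurable lebesgue" using f by (simp add: Lp_2pi_def)
      fix b :: real
      assume b: "0 < b" "(\<integral>\<^sup>+x\<in>torus. (phi (ennreal (p x)) (ennreal \<bar>f x\<bar> / ennreal b) * \<omega> x) \<partial>lebesgue) \<le> 1"
      have L1: "(\<integral>\<^sup>+x\<in>torus. ennreal \<bar>f x\<bar> \<partial>lebesgue) \<le> ennreal ((a + 1) * b)"
        by (rule L1_le_of_modular[OF p _ _ finite(1,3) b]) measurable
      have "AE x in lebesgue. x \<in> torus \<longrightarrow> averaging_operator Q f x \<le> ennreal ((a + 1) * b)"
        using averaging_le_L1[OF Q, of f] by eventually_elim (use L1 in \<open>auto intro: order_trans\<close>)
      then have "wnorm p \<omega> (averaging_operator Q f) \<le> ennreal (M * ((a + 1) * b))"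
        using finite(1) b(1) M by (intro wnorm_le_of_bound[OF p]) auto
      then show "wnorm p \<omega> (averaging_operator Q f) \<le> ennreal (M * (a + 1) * b)"
        by (simp add: mult.assoc)
    qed (use M finite(1) in simp)
    moreover have "0 < M * (a + 1)" using M finite(1) by simp
    ultimately show ?thesis by blast
  next
    case infinite
    have "wnorm p \<omega> (averaging_operator Q f) \<le> ennreal 1 * wnorm p \<omega> (\<lambda>x. ennreal \<bar>f x\<bar>)"
      if Q: "one_finite Q" "\<forall>U\<in>Q. emeasure lebesgue U = 1" and f: "f \<in> Lp_2pi p \<omega>" for Q f
    proof (rule le_const_wnormI)
      have [measurable]: "f \<in> borel_measurable lebesgue" using f by (simp add: Lp_2pi_def)
      fix b :: real
      assume b: "0 < b" "(\<integral>\<^sup>+x\<in>torus. (phi (ennreal (p x)) (ennreal \<bar>f x\<bar> / ennreal b) * \<omega> x) \<partial>lebesgue) \<le> 1"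
      have "AE x in lebesgue. x \<in> torus \<longrightarrow> f x = 0"
        using b by (intro modular_finite_imp_zero[OF p _ _ infinite]) (auto simp: top_unique)
      then have "(\<integral>\<^sup>+x\<in>torus. ennreal \<bar>f x\<bar> \<partial>lebesgue) = (\<integral>\<^sup>+x. 0 \<partial>(lebesgue :: real measure))"
        by (intro nn_integral_cong_AE) (auto elim!: eventually_mono split: split_indicator)
      then have "AE x in lebesgue. averaging_operator Q f x = 0"
        using averaging_le_L1[OF Q, of f] by simp
      then have "(\<integral>\<^sup>+x\<in>torus. (phi (ennreal (p x)) (averaging_operator Q f x / ennreal b) * \<omega> x) \<partial>lebesgue)
          = (\<integral>\<^sup>+x. 0 \<partial>(lebesgue :: real measure))"
        by (intro nn_integral_cong_AE) (auto elim!: eventually_mono simp: phi_def)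
      then show "wnorm p \<omega> (averaging_operator Q f) \<le> ennreal (1 * b)"
        unfolding wnorm_def using b by (intro Inf_lower) auto
    qed simp
    then show ?thesis using zero_less_one by blast
  qed
qed

end
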